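(* Let $d\ge1$, let $\lambda>0$, let $\mathbf x_s,\mathbf y_s\in\mathbb R^d$, $w_s>0$ and $o_s\in\{0,1\}$ for $s$ in a finite index set, and let $\boldsymbol\theta^*\in\mathbb R^d$. Let $\mu:\mathbb R\to\mathbb R$ be differentiable with $\kappa_\mu\le\dot\mu(\cdot)\le L_\mu$ for some constants $\kappa_\mu,L_\mu>0$. Then the function $G:\mathbb R^d\to\mathbb R^d$, $$G(\boldsymbol\theta)=\lambda\boldsymbol\theta+\sum_s w_s^2\big[\mu((\mathbf x_s-\mathbf y_s)^\top\boldsymbol\theta)-\mu((\mathbf x_s-\mathbf y_s)^\top\boldsymbol\theta^* )\big](\mathbf x_s-\mathbf y_s),$$ is a bijection from $\mathbb R^d$ to $\mathbb R^d$, and the regularized maximum likelihood equation $$\lambda\boldsymbol\theta+\sum_s w_s^2\big(\mu((\mathbf x_s-\mathbf y_s)^\top\boldsymbol\theta)-o_s\big)(\mathbf x_s-\mathbf y_s)=\mathbf 0$$ has a unique solution $\boldsymbol\theta\in\mathbb R^d$.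
   Context: $\dot\mu$ denotes the first derivative of $\mu$. *)

theory Defs
  imports "HOL-Analysis.Analysis"
begin

definition G_map ::
  "(real \<Rightarrow> real) \<Rightarrow> real \<Rightarrow> 's set \<Rightarrow> ('s \<Rightarrow> real ^ 'd) \<Rightarrow> ('s \<Rightarrow> real ^ 'd) \<Rightarrow> ('s \<Rightarrow> real)
    \<Rightarrow> real ^ 'd \<Rightarrow> real ^ 'd \<Rightarrow> real ^ 'd"
  where
  "G_map \<mu> lam S x y w \<theta>star \<theta> =
     lam *\<^sub>R \<theta> +
     (\<Sum>s\<in>S. ((w s)\<^sup>2 * (\<mu> ((x s - y s) \<bullet> \<theta>) - \<mu> ((x s - y s) \<bullet> \<theta>star))) *\<^sub>R (x s - y s))"

end

(* The map is lam-strongly monotone and Lipschitz, since mu is increasing and Lipschitz. For such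
   a map F and any p, the iteration v |-> v - eta (F v - p) with small eta > 0 is a contraction,
   and its unique fixed point is the unique solution of F v = p (Zarantonello's theorem). *)
theory Submission
  imports Defs
begin

theorem bij_of_strongly_monotone_lipschitz:
  fixes F :: "'a::{real_inner, complete_space} \<Rightarrow> 'a"
  assumes m: "m > 0"
    and mono: "\<And>u v. m * (norm (u - v))\<^sup>2 \<le> (F u - F v) \<bullet> (u - v)"
    and lip: "\<And>u v. norm (F u - F v) \<le> K * norm (u - v)"
  shows "bij F"
proof -
  \<comment> \<open>Cauchy-Schwarz forces \<open>m\<close> \<le> \<open>K\<close> as soon as the
    space is nonzero, but in the zero space \<open>K\<close> can be any real, even negative. The
    maximum covers both cases, so that division by \<open>M\<close> squared is safe and
    \<open>c\<close> is the root of a nonnegative number.\<close>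
  define M where "M = max K m"
  have M: "M > 0" "m \<le> M" "K \<le> M" using m by (auto simp: M_def)
  \<comment> \<open>This step size minimizes 1 - 2 \<eta> m + \<eta>^2 M^2, the bound obtained below
    for the squared contraction factor; the minimum is c^2.\<close>
  define \<eta> where "\<eta> = m / M\<^sup>2"
  define c where "c = sqrt (1 - m\<^sup>2 / M\<^sup>2)"
  have "m\<^sup>2 \<le> M\<^sup>2" using M m by (intro power_mono) auto
  then have c: "0 \<le> c" "c < 1" and c2: "c\<^sup>2 = 1 - m\<^sup>2 / M\<^sup>2"
    using M m by (auto simp: c_def)
  have "\<exists>!v. v - \<eta> *\<^sub>R (F v - p) = v" for p
  proof (rule banach_fix_type[OF c])
    show "\<forall>u v. dist (u - \<eta> *\<^sub>R (F u - p)) (v - \<eta> *\<^sub>R (F v - p)) \<le> c * dist u v"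
    proof (intro allI)
      fix u v :: 'a
      define a where "a = u - v"
      define b where "b = F u - F v"
      have ab: "m * (norm a)\<^sup>2 \<le> b \<bullet> a" using mono by (simp add: a_def b_def)
      have "norm b \<le> M * norm a"
        using lip[of u v] mult_right_mono[OF M(3), of "norm a"] by (simp add: a_def b_def)
      then have "(norm b)\<^sup>2 \<le> (M * norm a)\<^sup>2" by (intro power_mono) auto
      then have b2: "\<eta>\<^sup>2 * (norm b)\<^sup>2 \<le> \<eta>\<^sup>2 * (M\<^sup>2 * (norm a)\<^sup>2)"
        by (intro mult_left_mono) (auto simp: power_mult_distrib)
      have "\<eta> \<ge> 0" using M m by (simp add: \<eta>_def)
      then have ab': "\<eta> * (m * (norm a)\<^sup>2) \<le> \<eta> * (b \<bullet> a)"
        using ab by (intro mult_left_mono)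
      \<comment> \<open>After expanding the square, strong monotonicity controls the cross term and
        the Lipschitz bound the last one.\<close>
      have "(norm (a - \<eta> *\<^sub>R b))\<^sup>2 = (norm a)\<^sup>2 - 2 * (\<eta> * (b \<bullet> a)) + \<eta>\<^sup>2 * (norm b)\<^sup>2"
        by (simp only: power2_norm_eq_inner)
          (simp add: inner_diff_left inner_diff_right inner_commute power2_eq_square algebra_simps)
      also have "\<dots> \<le> (norm a)\<^sup>2 - 2 * (\<eta> * (m * (norm a)\<^sup>2)) + \<eta>\<^sup>2 * (M\<^sup>2 * (norm a)\<^sup>2)"
        using ab' b2 by linarith
      also have "\<dots> = (c * norm a)\<^sup>2"
        unfolding power_mult_distrib c2 \<eta>_def
        using M by (simp add: field_simps power2_eq_square)
      finally have "norm (a - \<eta> *\<^sub>R b) \<le> c * norm a"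
        by (rule power2_le_imp_le) (simp add: c)
      moreover have "(u - \<eta> *\<^sub>R (F u - p)) - (v - \<eta> *\<^sub>R (F v - p)) = a - \<eta> *\<^sub>R b"
        by (simp add: a_def b_def algebra_simps)
      ultimately show "dist (u - \<eta> *\<^sub>R (F u - p)) (v - \<eta> *\<^sub>R (F v - p)) \<le> c * dist u v"
        by (simp only: dist_norm a_def)
    qed
  qed
  moreover have "\<eta> \<noteq> 0" using M m by (simp add: \<eta>_def)
  ultimately have "\<exists>!v. F v = p" for p by simp
  then show ?thesis by (metis bij_iff)
qed

text \<open>The offsets \<open>b\<close> cancel in differences of the map, and the mean value
  theorem turns each increment of \<mu> into a slope in [0, L] times the increment of its argument.
  A difference of values is thus lam I + sum_s a_s q_s z_s z_s^T applied to \<open>u - v\<close>, a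
  bounded operator that dominates lam I.\<close>

lemma bij_ridge_sum:
  fixes z :: "'s \<Rightarrow> 'a::{real_inner, complete_space}" and \<mu> :: "real \<Rightarrow> real"
  assumes lam: "lam > 0" and a: "\<And>s. s \<in> S \<Longrightarrow> a s \<ge> 0" and "\<kappa> \<ge> 0"
    and diff: "\<And>t. \<mu> differentiable (at t)"
    and bounds: "\<And>t. \<kappa> \<le> deriv \<mu> t \<and> deriv \<mu> t \<le> L"
  shows "bij (\<lambda>\<theta>. lam *\<^sub>R \<theta> + (\<Sum>s\<in>S. (a s * (\<mu> (z s \<bullet> \<theta>) - b s)) *\<^sub>R z s))"
    (is "bij ?F")
proof -
  \<comment> \<open>Secant slopes, stated with a product rather than a quotient so that
    \<open>t = r\<close> is included.\<close>
  have slope: "\<exists>q. 0 \<le> q \<and> q \<le> L \<and> \<mu> t - \<mu> r = q * (t - r)" for t r :: real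
  proof -
    have D: "(\<mu> has_real_derivative deriv \<mu> u) (at u)" for u
      using diff by (simp add: DERIV_deriv_iff_real_differentiable)
    have *: "\<exists>q. 0 \<le> q \<and> q \<le> L \<and> \<mu> t - \<mu> r = q * (t - r)" if rt: "r < t" for r t
    proof -
      obtain u where "\<mu> t - \<mu> r = (t - r) * deriv \<mu> u"
        using MVT2[OF rt, of \<mu> "deriv \<mu>"] D by blast
      then show ?thesis
        using bounds[of u] \<open>\<kappa> \<ge> 0\<close> by (intro exI[of _ "deriv \<mu> u"]) (simp add: mult.commute)
    qed
    consider "r < t" | "t < r" | "r = t" by linarith
    then show ?thesis
    proof cases
      case 2
      then obtain q where "0 \<le> q" "q \<le> L" "\<mu> r - \<mu> t = q * (r - t)" using * by blast
      then show ?thesis by (intro exI[of _ q]) (simp add: algebra_simps)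
    next
      case 3
      then show ?thesis
        \<comment> \<open>Every slope fits here; 0 is admissible because 0 \<le> \<kappa> \<le>
          \<open>deriv \<mu> 0\<close> \<le> L.\<close>
        using bounds[of 0] \<open>\<kappa> \<ge> 0\<close> by (intro exI[of _ 0]) simp
    qed (use * in blast)
  qed
  \<comment> \<open>The slopes \<open>q\<close> may depend on \<open>u\<close> and \<open>v\<close>,
    but their bounds do not, so both hypotheses on the map can be read off this formula.\<close>
  have F_diff: "\<exists>q. (\<forall>s. 0 \<le> q s \<and> q s \<le> L) \<and>
      ?F u - ?F v = lam *\<^sub>R (u - v) + (\<Sum>s\<in>S. (a s * q s * (z s \<bullet> (u - v))) *\<^sub>R z s)" for u v :: 'a
  proof -
    have "\<forall>s. \<exists>q. 0 \<le> q \<and> q \<le> L \<and>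
        \<mu> (z s \<bullet> u) - \<mu> (z s \<bullet> v) = q * (z s \<bullet> u - z s \<bullet> v)"
      using slope by blast
    then obtain q where q: "\<And>s. 0 \<le> q s \<and> q s \<le> L \<and>
        \<mu> (z s \<bullet> u) - \<mu> (z s \<bullet> v) = q s * (z s \<bullet> u - z s \<bullet> v)"
      unfolding choice_iff by blast
    have "(a s * (\<mu> (z s \<bullet> u) - b s)) *\<^sub>R z s - (a s * (\<mu> (z s \<bullet> v) - b s)) *\<^sub>R z s
        = (a s * q s * (z s \<bullet> (u - v))) *\<^sub>R z s" for s
    proof -
      have "a s * (\<mu> (z s \<bullet> u) - b s) - a s * (\<mu> (z s \<bullet> v) - b s)
          = a s * (\<mu> (z s \<bullet> u) - \<mu> (z s \<bullet> v))" by (simp add: algebra_simps)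
      then show ?thesis
        using q[of s] by (simp add: scaleR_left_diff_distrib[symmetric] inner_diff_right)
    qed
    then have "?F u - ?F v
        = lam *\<^sub>R (u - v) + (\<Sum>s\<in>S. (a s * q s * (z s \<bullet> (u - v))) *\<^sub>R z s)"
      by (simp add: sum_subtractf[symmetric] scaleR_right_diff_distrib add_diff_add)
    then show ?thesis using q by blast
  qed
  show ?thesis
  proof (rule bij_of_strongly_monotone_lipschitz[OF lam])
    fix u v :: 'a
    obtain q where q: "\<And>s. 0 \<le> q s \<and> q s \<le> L"
      and eq: "?F u - ?F v = lam *\<^sub>R (u - v) + (\<Sum>s\<in>S. (a s * q s * (z s \<bullet> (u - v))) *\<^sub>R z s)"
      using F_diff by blast
    \<comment> \<open>Paired with \<open>u - v\<close>, each rank-one term becomes a nonnegative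
      multiple of a square, which leaves the ridge term as lower bound.\<close>
    have "0 \<le> (\<Sum>s\<in>S. a s * q s * (z s \<bullet> (u - v)) * (z s \<bullet> (u - v)))"
      using a q by (intro sum_nonneg) (simp add: mult.assoc)
    then show "lam * (norm (u - v))\<^sup>2 \<le> (?F u - ?F v) \<bullet> (u - v)"
      unfolding eq by (simp add: inner_add_left inner_sum_left power2_norm_eq_inner)
    have "norm ((a s * q s * (z s \<bullet> (u - v))) *\<^sub>R z s)
        \<le> a s * L * (norm (z s))\<^sup>2 * norm (u - v)" if "s \<in> S" for s
    proof -
      have "norm ((a s * q s * (z s \<bullet> (u - v))) *\<^sub>R z s)
          = (a s * q s) * (\<bar>z s \<bullet> (u - v)\<bar> * norm (z s))"
        using a[OF that] q[of s] by (simp add: abs_mult)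
      also have "\<dots> \<le> (a s * L) * ((norm (z s) * norm (u - v)) * norm (z s))"
        \<comment> \<open>The \<open>order_trans\<close> instance supplies 0 \<le> L, a side
          condition of \<open>mult_mono\<close>.\<close>
        using a[OF that] q[of s] order_trans[of 0 "q s" L] Cauchy_Schwarz_ineq2[of "z s" "u - v"]
        by (intro mult_mono mult_nonneg_nonneg) auto
      finally show ?thesis by (simp add: power2_eq_square mult_ac)
    qed
    then have "norm (\<Sum>s\<in>S. (a s * q s * (z s \<bullet> (u - v))) *\<^sub>R z s)
        \<le> (\<Sum>s\<in>S. a s * L * (norm (z s))\<^sup>2) * norm (u - v)"
      unfolding sum_distrib_right by (rule sum_norm_le)
    moreover have "norm (lam *\<^sub>R (u - v)) = lam * norm (u - v)" using lam by simp
    ultimately show "norm (?F u - ?F v)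
        \<le> (lam + (\<Sum>s\<in>S. a s * L * (norm (z s))\<^sup>2)) * norm (u - v)"
      unfolding eq distrib_right by (intro norm_triangle_le) linarith
  qed
qed

theorem mainTheorem2:
  fixes S :: "'s set"
    and x y :: "'s \<Rightarrow> real ^ 'd"
    and w outcome :: "'s \<Rightarrow> real"
    and \<theta>star :: "real ^ 'd"
    and \<mu> :: "real \<Rightarrow> real"
    and lam \<kappa> L :: real
  assumes "lam > 0"
    and "finite S"
    and "\<And>s. s \<in> S \<Longrightarrow> w s > 0"
    and "\<And>s. s \<in> S \<Longrightarrow> outcome s \<in> {0, 1}"
    and "\<kappa> > 0" and "L > 0"
    and "\<And>t. \<mu> differentiable (at t)"
    and "\<And>t. \<kappa> \<le> deriv \<mu> t \<and> deriv \<mu> t \<le> L"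
  shows "bij (G_map \<mu> lam S x y w \<theta>star) \<and>
    (\<exists>!\<theta>. lam *\<^sub>R \<theta> +
       (\<Sum>s\<in>S. ((w s)\<^sup>2 * (\<mu> ((x s - y s) \<bullet> \<theta>) - outcome s)) *\<^sub>R (x s - y s)) = 0)"
proof -
  \<comment> \<open>Both claims are instances: the offset
    \<open>\<mu> ((x s - y s) \<bullet> \<theta>star)\<close> gives \<open>G_map\<close>, and the
    offset \<open>outcome s\<close> gives the likelihood equation as the fibre over 0.\<close>
  have bij: "bij (\<lambda>\<theta>. lam *\<^sub>R \<theta> +
      (\<Sum>s\<in>S. ((w s)\<^sup>2 * (\<mu> ((x s - y s) \<bullet> \<theta>) - b s)) *\<^sub>R (x s - y s)))" for b
    using assms by (intro bij_ridge_sum[where \<kappa> = \<kappa> and L = L]) auto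
  have "bij (G_map \<mu> lam S x y w \<theta>star)"
    unfolding G_map_def[abs_def] by (rule bij)
  moreover have "\<exists>!\<theta>. lam *\<^sub>R \<theta> +
      (\<Sum>s\<in>S. ((w s)\<^sup>2 * (\<mu> ((x s - y s) \<bullet> \<theta>) - outcome s)) *\<^sub>R (x s - y s)) = 0"
    using bij[of outcome] by (simp only: bij_iff)
  ultimately show ?thesis ..
qed

end
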